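(* Let $G$ be a simple graph and $c$ a positive integer. Then $G$ has chromatic number $c$ if and only if for every $s\in\mathbb{N}$ the $s$-jet graph $\mathcal{J}_s(G)$ has chromatic number $c$.
   Context: For a simple graph $G$ with vertex set $\{x_1,\dots,x_n\}$ and $s\in\mathbb{N}$, the $s$-jet graph $\mathcal{J}_s(G)$ is the simple graph with vertex set $\{x_{i,j}\mid i=1,\dots,n,\ j=0,\dots,s\}$ in which $\{x_{i,j},x_{k,l}\}$ is an edge if and only if $\{x_i,x_k\}$ is an edge of $G$ and $j+l\leqslant s$. (Equivalently, it is the graph whose edge ideal is the radical of the ideal of $s$-jets of the edge ideal of $G$.) Note $\mathcal{J}_0(G)\cong G$. *)

theory Defs
  imports "Graph_Theory.Pair_Digraph"
begin

text \<open>
  A finite simple graph is a \<^locale>\<open>pair_graph\<close>: a finite vertex set with a symmetric,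
  irreflexive relation \<^const>\<open>parcs\<close> on it. The undirected edge between \<open>u\<close> and \<open>v\<close>
  corresponds to the two arcs \<open>(u, v)\<close> and \<open>(v, u)\<close>.
\<close>

definition jet_graph :: "nat \<Rightarrow> 'a pair_pre_digraph \<Rightarrow> ('a \<times> nat) pair_pre_digraph" where
  "jet_graph s G =
     \<lparr> pverts = pverts G \<times> {0..s},
       parcs = {((x, j), (y, l)) | x j y l.
                  j \<in> {0..s} \<and> l \<in> {0..s} \<and> (x, y) \<in> parcs G \<and> j + l \<le> s} \<rparr>"

definition proper_coloring :: "'a pair_pre_digraph \<Rightarrow> nat \<Rightarrow> ('a \<Rightarrow> nat) \<Rightarrow> bool" where
  "proper_coloring G k f \<longleftrightarrow>
     (\<forall>v \<in> pverts G. f v < k) \<and> (\<forall>(u, v) \<in> parcs G. f u \<noteq> f v)"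

text \<open>
  For a finite loopfree graph the minimum is attained, see \<open>proper_coloring_card\<close> below.
  The graph without vertices has chromatic number 0.
\<close>

definition chromatic_number :: "'a pair_pre_digraph \<Rightarrow> nat" where
  "chromatic_number G = (LEAST k. \<exists>f. proper_coloring G k f)"

lemma (in pair_graph) proper_coloring_card: "\<exists>f. proper_coloring G (card (pverts G)) f"
proof -
  obtain f where f: "bij_betw f (pverts G) {0..<card (pverts G)}"
    using ex_bij_betw_finite_nat[OF pair_finite_verts] by blast
  have "f u \<noteq> f v" if "(u, v) \<in> parcs G" for u v
    using f that in_arcsD1[OF that] in_arcsD2[OF that] pair_no_loops[OF that]
    by (auto simp: bij_betw_def dest: inj_onD)
  moreover have "f v < card (pverts G)" if "v \<in> pverts G" for v
    using f that by (auto simp: bij_betw_def)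
  ultimately show ?thesis
    by (auto simp: proper_coloring_def)
qed

lemma (in pair_graph) pair_graph_jet_graph: "pair_graph (jet_graph s G)"
proof -
  let ?J = "jet_graph s G"
  have sub: "parcs ?J \<subseteq> pverts ?J \<times> pverts ?J"
    by (auto simp: jet_graph_def dest: in_arcsD1 in_arcsD2)
  have fin: "finite (pverts ?J)"
    using pair_finite_verts by (simp add: jet_graph_def)
  have symG: "(v, u) \<in> parcs G" if "(u, v) \<in> parcs G" for u v
    using pair_sym_arcs that by (auto simp: symmetric_def dest: symD)
  show ?thesis
  proof
    show "finite (parcs ?J)"
      using sub fin by (meson finite_SigmaI finite_subset)
    show "symmetric (with_proj ?J)"
      by (auto simp: symmetric_def sym_def jet_graph_def add.commute intro: symG)
    show "fst e \<noteq> snd e" if "e \<in> parcs ?J" for e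
      using that by (auto simp: jet_graph_def dest: pair_no_loops)
  qed (use sub fin in auto)
qed

end

theory Submission
  imports Defs
begin

text \<open>
  The projection \<open>(x, j) \<mapsto> x\<close> from the jet graph to \<open>G\<close> and the section \<open>x \<mapsto> (x, 0)\<close> are both
  graph homomorphisms, so colorings can be pulled back in either direction.
\<close>

lemma proper_coloring_jet_graph:
  assumes "proper_coloring G k f"
  shows "proper_coloring (jet_graph s G) k (f \<circ> fst)"
  using assms by (fastforce simp: proper_coloring_def jet_graph_def)

text \<open>Level 0 of the jet graph is a full copy of \<open>G\<close>: for j = l = 0 the condition
  \<open>j + l \<le> s\<close> holds for every \<open>s\<close>.\<close>

lemma proper_coloring_of_jet_graph:
  assumes "proper_coloring (jet_graph s G) k f"
  shows "proper_coloring G k (\<lambda>x. f (x, 0))"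
  using assms by (fastforce simp: proper_coloring_def jet_graph_def)

lemma chromatic_number_jet_graph: "chromatic_number (jet_graph s G) = chromatic_number G"
proof -
  \<comment> \<open>\<open>chromatic_number\<close> depends only on which \<open>k\<close> admit a
    coloring, so agreement for each \<open>k\<close> suffices.\<close>
  have "(\<exists>f. proper_coloring (jet_graph s G) k f) \<longleftrightarrow> (\<exists>f. proper_coloring G k f)" for k
    by (blast intro: proper_coloring_jet_graph proper_coloring_of_jet_graph)
  then show ?thesis
    by (simp add: chromatic_number_def)
qed

theorem theorem2:
  fixes G :: "'a pair_pre_digraph" and c :: nat
  assumes "pair_graph G" and "c > 0"
  shows "chromatic_number G = c \<longleftrightarrow> (\<forall>s::nat. chromatic_number (jet_graph s G) = c)"
  \<comment> \<open>After rewriting, the right-hand side no longer depends on \<open>s\<close>, so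
    the quantifier collapses and both sides coincide.\<close>
  by (simp add: chromatic_number_jet_graph)

end
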